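(* Let $q\ge 27$ be a prime power with $q\equiv 3\pmod 4$, let $\xi$ be a primitive element of $F_q$, and let $J$ be an integer with $(q-3)/4\le J\le (q-3)/2$. Let $\mathcal{D}_J=\{(1,\xi^d,\xi^{2d}): d=0,1,\dots,J\}$, $P=(0,1,0)$, $Z=(1,0,-1)$, $B_J=(1,0,-\xi^{2J})$. Then $\mathcal{E}_J=\mathcal{D}_J\cup\{P,Z,B_J\}$ is a $(J+4)$-arc in $PG(2,q)$.
   Context: Points of $PG(2,q)$ are in homogeneous coordinates $(x_0,x_1,x_2)$. An arc is a set of points no three collinear. *)

theory Defs
  imports "HOL-Analysis.Analysis" "HOL-Number_Theory.Number_Theory"
begin

(* PG(2,F): points and lines are the subspaces of F^3 of vector-space dimension 1 and 2,
   incidence is inclusion. *)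

definition pg_points :: "('a::field ^ 3) set set" where
  "pg_points = {p. vec.subspace p \<and> vec.dim p = 1}"

definition pg_lines :: "('a::field ^ 3) set set" where
  "pg_lines = {l. vec.subspace l \<and> vec.dim l = 2}"

definition pg_pt :: "'a::field \<Rightarrow> 'a \<Rightarrow> 'a \<Rightarrow> ('a ^ 3) set" where
  "pg_pt x0 x1 x2 = vec.span {vector [x0, x1, x2]}"

definition pg_collinear :: "('a::field ^ 3) set set \<Rightarrow> bool" where
  "pg_collinear S \<longleftrightarrow> (\<exists>l\<in>pg_lines. \<forall>p\<in>S. p \<subseteq> l)"

definition pg_arc :: "('a::field ^ 3) set set \<Rightarrow> bool" where
  "pg_arc A \<longleftrightarrow> A \<subseteq> pg_points \<and> (\<forall>S\<subseteq>A. card S = 3 \<longrightarrow> \<not> pg_collinear S)"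

definition pg_k_arc :: "nat \<Rightarrow> ('a::field ^ 3) set set \<Rightarrow> bool" where
  "pg_k_arc k A \<longleftrightarrow> pg_arc A \<and> finite A \<and> card A = k"

definition primitive_element :: "'a::field \<Rightarrow> bool" where
  "primitive_element x \<longleftrightarrow> range (\<lambda>n::nat. x ^ n) = UNIV - {0}"

definition D_set :: "'a::field \<Rightarrow> int \<Rightarrow> ('a ^ 3) set set" where
  "D_set \<xi> J = {pg_pt 1 (\<xi> powi d) (\<xi> powi (2 * d)) | d. 0 \<le> d \<and> d \<le> J}"

definition E_set :: "'a::field \<Rightarrow> int \<Rightarrow> ('a ^ 3) set set" where
  "E_set \<xi> J = D_set \<xi> J \<union> {pg_pt 0 1 0, pg_pt 1 0 (-1), pg_pt 1 0 (- (\<xi> powi (2 * J)))}"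

end

theory Submission imports Defs begin

text \<open>
  Three points are non-collinear once the determinant of their coordinate vectors is nonzero, and
  for the triples of \<open>\<E>\<^sub>J\<close> this determinant factors explicitly. Writing \<open>a = \<xi>\<^sup>i\<close>, \<open>b = \<xi>\<^sup>j\<close> with
  \<open>0 \<le> i < j \<le> J\<close>, collinearity of the two points of \<open>\<D>\<^sub>J\<close> with \<open>P\<close>, \<open>Z\<close> or \<open>B\<^sub>J\<close> means \<open>a\<^sup>2 = b\<^sup>2\<close>,
  \<open>a b = 1\<close> or \<open>a b = \<xi>\<^bsup>2J\<^esup>\<close>; all exponents lie in \<open>{0..2J}\<close> with \<open>2J < q - 1\<close>, so comparing them rules
  this out. A triple with \<open>P\<close>, one of \<open>Z\<close>, \<open>B\<^sub>J\<close>, and one point of \<open>\<D>\<^sub>J\<close> would make \<open>-1\<close> a square,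
  impossible for \<open>q \<equiv> 3 (mod 4)\<close>.
\<close>

section \<open>Arcs from nonvanishing determinants\<close>

lemma not_pg_collinear_if_det_nonzero:
  fixes u v w :: "'a::field ^ 3"
  assumes "det (vector [u, v, w]) \<noteq> 0"
  shows "\<not> pg_collinear {vec.span {u}, vec.span {v}, vec.span {w}}"
proof
  assume "pg_collinear {vec.span {u}, vec.span {v}, vec.span {w}}"
  then obtain l where l: "vec.subspace l" "vec.dim l = 2" "{u, v, w} \<subseteq> l"
    unfolding pg_collinear_def pg_lines_def by (auto simp: vec.span_base subset_iff)
  define A :: "'a ^ 3 ^ 3" where "A = vector [u, v, w]"
  \<comment> \<open>Rows of an invertible matrix span the whole space, so a subspace containing them
    cannot have dimension 2.\<close>
  have "\<exists>B. B ** A = mat 1"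
    using assms invertible_det_nz[of A] by (auto simp: A_def invertible_def)
  then have "vec.span (rows A) = UNIV"
    by (simp add: matrix_left_invertible_span_rows_gen)
  moreover have "rows A \<subseteq> l"
    using l by (auto simp: rows_def row_def A_def UNIV_3)
  ultimately have "l = UNIV"
    using l(1) vec.span_minimal by blast
  then show False
    using l(2) by (simp add: card_cart_basis)
qed

lemma det_vector_3_permute:
  fixes u v w :: "'a::comm_ring_1 ^ 3"
  shows "det (vector [u, w, v]) = - det (vector [u, v, w])"
    and "det (vector [v, u, w]) = - det (vector [u, v, w])"
    and "det (vector [w, v, u]) = - det (vector [u, v, w])"
    and "det (vector [v, w, u]) = det (vector [u, v, w])"
    and "det (vector [w, u, v]) = det (vector [u, v, w])"
  by (simp_all add: det_3 algebra_simps)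

text \<open>Permuting rows changes at most the sign, so only increasing index triples need an
  explicit computation.\<close>

lemma det_vector_3_nonzero_if_ordered:
  fixes f :: "nat \<Rightarrow> 'a::comm_ring_1 ^ 3"
  assumes ordered: "\<And>i j k. i < j \<Longrightarrow> j < k \<Longrightarrow> k < n \<Longrightarrow> det (vector [f i, f j, f k]) \<noteq> 0"
    and "i \<noteq> j" "j \<noteq> k" "i \<noteq> k" "i < n" "j < n" "k < n"
  shows "det (vector [f i, f j, f k]) \<noteq> 0"
proof -
  consider "i < j" "j < k" | "i < k" "k < j" | "j < i" "i < k" | "j < k" "k < i"
    | "k < i" "i < j" | "k < j" "j < i"
    using assms(2-4) by linarith
  then show ?thesis
    using ordered[of i j k] ordered[of i k j] ordered[of j i k] ordered[of j k i]
      ordered[of k i j] ordered[of k j i] assms(5-7)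
    unfolding det_vector_3_permute[where u = "f i" and v = "f j" and w = "f k"]
    by cases simp_all
qed

text \<open>A zero vector or two proportional vectors would make the determinant vanish, so the same
  condition also shows that the spans are points and pairwise distinct.\<close>

lemma pg_k_arc_if_det_nonzero:
  fixes f :: "nat \<Rightarrow> 'a::field ^ 3"
  assumes "3 \<le> n"
    and ordered: "\<And>i j k. i < j \<Longrightarrow> j < k \<Longrightarrow> k < n \<Longrightarrow> det (vector [f i, f j, f k]) \<noteq> 0"
  shows "pg_k_arc n ((\<lambda>i. vec.span {f i}) ` {..<n})"
proof -
  let ?p = "\<lambda>i. vec.span {f i}"
  have nz: "det (vector [f i, f j, f k]) \<noteq> 0"
    if "i \<noteq> j" "j \<noteq> k" "i \<noteq> k" "i < n" "j < n" "k < n" for i j k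
    using det_vector_3_nonzero_if_ordered[of n f] ordered that by blast
  \<comment> \<open>The case \<open>i = j\<close> is allowed; it supplies the second index when only
    one is given.\<close>
  have third: "\<exists>k<n. k \<noteq> i \<and> k \<noteq> j" for i j
  proof -
    have "card {i, j} < card {..<n}"
      using assms(1) card_insert_le_m1[of 2 "{j}" i] by simp
    then show ?thesis
      by (metis card_mono finite.emptyI finite.insertI insertCI leD lessThan_iff subsetI)
  qed
  have nonzero: "f i \<noteq> 0" if "i < n" for i
  proof -
    obtain j where j: "j < n" "j \<noteq> i" using third by blast
    obtain k where k: "k < n" "k \<noteq> i" "k \<noteq> j" using third by blast
    have "det (vector [f i, f j, f k]) \<noteq> 0" using nz j k that by metis
    then show ?thesis by (auto simp: det_3)
  qed
  have inj: "inj_on ?p {..<n}"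
  proof (rule inj_onI, rule ccontr)
    fix i j assume ij: "i \<in> {..<n}" "j \<in> {..<n}" "?p i = ?p j" "i \<noteq> j"
    then obtain k where k: "k < n" "k \<noteq> i" "k \<noteq> j" using third by blast
    have "f i \<in> ?p j" using ij(3) vec.span_base by blast
    then obtain c where "f i = c *s f j"
      by (auto simp: vec.span_singleton)
    then have "det (vector [f i, f j, f k]) = 0"
      by (simp add: det_3 algebra_simps)
    then show False using nz[of i j k] ij k by auto
  qed
  have points: "?p ` {..<n} \<subseteq> pg_points"
    using nonzero by (auto simp: pg_points_def)
  have "\<not> pg_collinear S" if S: "S \<subseteq> ?p ` {..<n}" "card S = 3" for S
  proof -
    obtain T where T: "T \<subseteq> {..<n}" "S = ?p ` T"
      using S(1) by (meson subset_imageE)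
    then have "card T = 3"
      using S(2) inj by (metis card_image inj_on_subset)
    then obtain i j k where ijk: "T = {i, j, k}" "i \<noteq> j" "j \<noteq> k" "i \<noteq> k"
      by (auto simp: card_3_iff)
    then have "det (vector [f i, f j, f k]) \<noteq> 0"
      using nz T(1) by simp
    from not_pg_collinear_if_det_nonzero[OF this] show ?thesis
      using T ijk by simp
  qed
  then show ?thesis
    using points inj by (simp add: pg_k_arc_def pg_arc_def card_image)
qed

section \<open>Powers of a primitive element\<close>

context
  fixes \<xi> :: "'a::{field,finite}"
  assumes prim: "primitive_element \<xi>"
begin

lemma primitive_element_nonzero: "\<xi> \<noteq> 0"
  using prim unfolding primitive_element_def
  by (metis DiffD2 insertI1 power_one_right rangeI)

text \<open>If \<open>\<xi> ^ m = 1\<close>, exponents reduce modulo \<open>m\<close>, and at most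
  \<open>m\<close> powers are too few to exhaust the nonzero elements.\<close>

lemma primitive_element_power_neq_1:
  assumes "0 < m" "m < CARD('a) - 1"
  shows "\<xi> ^ m \<noteq> 1"
proof
  assume 1: "\<xi> ^ m = 1"
  have "\<xi> ^ n \<in> (\<lambda>i. \<xi> ^ i) ` {..<m}" for n
  proof -
    have "\<xi> ^ n = \<xi> ^ (m * (n div m) + n mod m)" by simp
    also have "\<dots> = \<xi> ^ (n mod m)"
      unfolding power_add power_mult 1 by simp
    finally show ?thesis using assms(1) by auto
  qed
  then have "range (\<lambda>n. \<xi> ^ n) \<subseteq> (\<lambda>i. \<xi> ^ i) ` {..<m}"
    by (rule image_subsetI)
  then have "UNIV - {0} \<subseteq> (\<lambda>i. \<xi> ^ i) ` {..<m}"
    using prim by (simp only: primitive_element_def)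
  then have "card (UNIV - {0 :: 'a}) \<le> card {..<m}"
    by (rule surj_card_le[OF finite_lessThan])
  then show False using assms(2) by simp
qed

lemma primitive_element_power_inj:
  assumes "\<xi> ^ m = \<xi> ^ n" "m < n + (CARD('a) - 1)" "n < m + (CARD('a) - 1)"
  shows "m = n"
proof -
  have "n \<le> m" if "\<xi> ^ m = \<xi> ^ n" "n < m + (CARD('a) - 1)" for m n
  proof (rule ccontr)
    assume "\<not> n \<le> m"
    then have "\<xi> ^ n = \<xi> ^ m * \<xi> ^ (n - m)"
      by (simp flip: power_add)
    then have "\<xi> ^ (n - m) = 1"
      using that(1) primitive_element_nonzero by simp
    then show False
      using primitive_element_power_neq_1[of "n - m"] that(2) \<open>\<not> n \<le> m\<close> by simp
  qed
  then show ?thesis using assms by (metis le_antisym)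
qed

text \<open>Multiplication by \<open>\<xi>\<close> permutes the nonzero elements; compare their
  product before and after.\<close>

lemma primitive_element_power_card: "\<xi> ^ (CARD('a) - 1) = 1"
proof -
  let ?S = "UNIV - {0 :: 'a}"
  have "bij_betw ((*) \<xi>) ?S ?S"
    by (rule bij_betwI[where g = "\<lambda>x. x / \<xi>"]) (auto simp: primitive_element_nonzero)
  then have "prod (\<lambda>x. x) ?S = (\<Prod>x\<in>?S. \<xi> * x)"
    by (metis (no_types, lifting) prod.cong prod.reindex_bij_betw)
  also have "\<dots> = \<xi> ^ (CARD('a) - 1) * prod (\<lambda>x. x) ?S"
    by (simp add: prod.distrib)
  finally show ?thesis by simp
qed

text \<open>Otherwise \<open>-1\<close> is the square of a power of \<open>\<xi>\<close>. Raising to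
  the odd exponent \<open>h\<close>, half of \<open>CARD('a) - 1\<close>, gives
  \<open>-1 = 1\<close>.\<close>

lemma sum_of_squares_nonzero:
  fixes x y :: 'a
  assumes "[CARD('a) = 3] (mod 4)" "y \<noteq> 0"
  shows "x ^ 2 + y ^ 2 \<noteq> 0"
proof
  assume "x ^ 2 + y ^ 2 = 0"
  then have z: "(x / y) ^ 2 = -1"
    using assms(2) by (simp add: field_simps eq_neg_iff_add_eq_0)
  then have "x / y \<in> UNIV - {0}" by auto
  then obtain n where n: "x / y = \<xi> ^ n"
    using prim unfolding primitive_element_def by blast
  have mod: "CARD('a) mod 4 = 3"
    using assms(1) by (simp add: cong_def)
  define h where "h = (CARD('a) - 1) div 2"
  have h: "CARD('a) - 1 = 2 * h" "odd h" "0 < h"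
    using mod unfolding h_def by presburger+
  \<comment> \<open>A square root of 1 other than 1 must be \<open>-1\<close>, so the characteristic
    is not 2.\<close>
  have "(\<xi> ^ h) ^ 2 = 1"
    using primitive_element_power_card h(1) by (simp add: mult.commute flip: power_mult)
  moreover have "\<xi> ^ h \<noteq> 1"
    using primitive_element_power_neq_1 h by simp
  ultimately have "(1 :: 'a) \<noteq> -1"
    by (auto simp: power2_eq_1_iff)
  moreover have "((x / y) ^ 2) ^ h = (\<xi> ^ (2 * h)) ^ n"
    by (simp add: n mult_ac flip: power_mult)
  then have "(-1 :: 'a) = 1"
    using primitive_element_power_card h z by simp
  ultimately show False by simp
qed

end

theorem theorem19:
  fixes \<xi> :: "'a::{field,finite}" and q :: nat and J :: int
  assumes "primepow q" and "CARD('a) = q"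
    and "q \<ge> 27" and "[q = 3] (mod 4)"
    and "primitive_element \<xi>"
    and "(real q - 3) / 4 \<le> real_of_int J" and "real_of_int J \<le> (real q - 3) / 2"
  shows "pg_k_arc (nat (J + 4)) (E_set \<xi> J)"
proof -
  note prim = assms(5)
  have bounds: "int q - 3 \<le> 4 * J" "2 * J \<le> int q - 3"
    unfolding of_int_le_iff[where 'a = real, symmetric] using assms(6,7) by simp_all
  define N where "N = nat J"
  \<comment> \<open>Positivity of \<open>N\<close> separates Z from B_J; the second bound makes
    powers with exponents in \<open>0..2 * N\<close> distinct.\<close>
  have J: "J = int N" and N: "0 < N" "2 * N < q - 1" "3 \<le> N + 4"
    using bounds assms(3) unfolding N_def by linarith+
  \<comment> \<open>The points of D_J come first, then P, Z, B_J, so an increasing triple has one of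
    eight types, which name the cases below.\<close>
  define f :: "nat \<Rightarrow> 'a ^ 3" where
    "f i = (if i \<le> N then vector [1, \<xi> ^ i, (\<xi> ^ i)\<^sup>2] else if i = N + 1 then vector [0, 1, 0]
      else if i = N + 2 then vector [1, 0, -1] else vector [1, 0, - (\<xi> ^ N)\<^sup>2])" for i
  have f: "\<And>i. i \<le> N \<Longrightarrow> f i = vector [1, \<xi> ^ i, (\<xi> ^ i)\<^sup>2]"
      "f (N + 1) = vector [0, 1, 0]" "f (N + 2) = vector [1, 0, -1]"
      "f (N + 3) = vector [1, 0, - (\<xi> ^ N)\<^sup>2]"
    by (auto simp: f_def)
  have nz: "\<xi> \<noteq> 0" using primitive_element_nonzero[OF prim] .
  have inj: "m = n" if "\<xi> ^ m = \<xi> ^ n" "m \<le> 2 * N" "n \<le> 2 * N" for m n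
    using primitive_element_power_inj[OF prim that(1)] that(2,3) N assms(2) by linarith
  have sq: "x\<^sup>2 + y\<^sup>2 \<noteq> 0" if "y \<noteq> 0" for x y :: 'a
    using sum_of_squares_nonzero[OF prim] assms(2,4) that by blast
  have det_nz: "det (vector [f i, f j, f k]) \<noteq> 0" if ijk: "i < j" "j < k" "k < N + 4" for i j k
  proof -
    have "i \<le> N \<or> i = N + 1" "j \<le> N \<or> j = N + 1 \<or> j = N + 2"
      "k \<le> N \<or> k = N + 1 \<or> k = N + 2 \<or> k = N + 3"
      using ijk by linarith+
    then consider (DDD) "k \<le> N" | (DDP) "j \<le> N" "k = N + 1"
      | (DDZ) "j \<le> N" "k = N + 2" | (DDB) "j \<le> N" "k = N + 3"
      | (DPZ) "i \<le> N" "j = N + 1" "k = N + 2" | (DPB) "i \<le> N" "j = N + 1" "k = N + 3"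
      | (DZB) "i \<le> N" "j = N + 2" "k = N + 3" | (PZB) "i = N + 1" "j = N + 2" "k = N + 3"
      using ijk by (elim disjE) simp_all
    then show ?thesis
    proof cases
      case DDD
      then have "\<xi> ^ i \<noteq> \<xi> ^ j" "\<xi> ^ j \<noteq> \<xi> ^ k" "\<xi> ^ i \<noteq> \<xi> ^ k"
        using inj[of i j] inj[of j k] inj[of i k] ijk by auto
      \<comment> \<open>Vandermonde determinant.\<close>
      moreover have "det (vector [f i, f j, f k])
          = (\<xi> ^ j - \<xi> ^ i) * (\<xi> ^ k - \<xi> ^ i) * (\<xi> ^ k - \<xi> ^ j)"
        using DDD ijk by (simp add: f[simplified] det_3 power2_eq_square algebra_simps)
      ultimately show ?thesis by simp
    next
      case DDP
      have "det (vector [f i, f j, f k]) = \<xi> ^ (2 * i) - \<xi> ^ (2 * j)"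
        using DDP ijk by (simp add: f[simplified] det_3 power_even_eq)
      then show ?thesis using inj[of "2 * i" "2 * j"] DDP ijk by auto
    next
      case DDZ
      \<comment> \<open>From \<open>i < j \<le> N\<close>, the exponent \<open>i + j\<close> lies
        strictly between 0 and \<open>2 * N\<close>, which settles both this case and the next.
        Writing 1 as \<open>\<xi> ^ 0\<close> lets \<open>inj\<close> apply.\<close>
      have "det (vector [f i, f j, f k]) = (\<xi> ^ j - \<xi> ^ i) * (\<xi> ^ (i + j) - \<xi> ^ 0)"
        using DDZ ijk by (simp add: f[simplified] det_3 power2_eq_square power_add algebra_simps)
      then show ?thesis using inj[of i j] inj[of "i + j" 0] DDZ ijk by auto
    next
      case DDB
      have "det (vector [f i, f j, f k]) = (\<xi> ^ j - \<xi> ^ i) * (\<xi> ^ (i + j) - \<xi> ^ (2 * N))"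
        using DDB ijk by (simp add: f[simplified] det_3 power2_eq_square power_add mult_2_right algebra_simps)
      then show ?thesis using inj[of i j] inj[of "i + j" "2 * N"] DDB ijk by auto
    next
      case DPZ
      have "det (vector [f i, f j, f k]) = - ((\<xi> ^ i)\<^sup>2 + 1\<^sup>2)"
        using DPZ by (simp add: f[simplified] det_3)
      then show ?thesis using sq[of 1 "\<xi> ^ i"] by (metis neg_equal_0_iff_equal one_neq_zero)
    next
      case DPB
      have "det (vector [f i, f j, f k]) = - ((\<xi> ^ i)\<^sup>2 + (\<xi> ^ N)\<^sup>2)"
        using DPB by (simp add: f[simplified] det_3)
      then show ?thesis using sq[of "\<xi> ^ N" "\<xi> ^ i"] nz
        by (metis neg_equal_0_iff_equal power_not_zero)
    next
      case DZB
      \<comment> \<open>Z and B_J lie on the line x_1 = 0: the first factor keeps the point of D_J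
        off it, the second keeps Z and B_J apart.\<close>
      have "det (vector [f i, f j, f k]) = \<xi> ^ i * (\<xi> ^ (2 * N) - \<xi> ^ 0)"
        using DZB by (simp add: f[simplified] det_3 power_even_eq right_diff_distrib)
      then show ?thesis using inj[of "2 * N" 0] nz N by auto
    next
      case PZB
      have "det (vector [f i, f j, f k]) = \<xi> ^ (2 * N) - \<xi> ^ 0"
        using PZB by (simp add: f[simplified] det_3 power_even_eq right_diff_distrib)
      then show ?thesis using inj[of "2 * N" 0] N by auto
    qed
  qed
  have "D_set \<xi> J = (\<lambda>i. vec.span {f i}) ` {..N}"
  proof -
    \<comment> \<open>The integer exponents are nonnegative, so \<open>powi\<close> becomes the
      ordinary power used in \<open>f\<close>.\<close>
    have "{d. 0 \<le> d \<and> d \<le> J} = int ` {..N}"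
      unfolding J by (auto dest!: zero_le_imp_eq_int)
    then have "D_set \<xi> J = (\<lambda>d. pg_pt 1 (\<xi> powi d) (\<xi> powi (2 * d))) ` int ` {..N}"
      by (simp only: D_set_def setcompr_eq_image)
    also have "\<dots> = (\<lambda>i. vec.span {f i}) ` {..N}"
      unfolding image_image
      by (intro image_cong)
        (simp_all add: pg_pt_def f power_int_def nat_mult_distrib power_even_eq)
    finally show ?thesis .
  qed
  moreover have "{..<N + 4} = {..N} \<union> {N + 1, N + 2, N + 3}" by auto
  moreover have "\<xi> powi (2 * J) = (\<xi> ^ N)\<^sup>2"
    by (simp add: J power_int_def nat_mult_distrib power_even_eq)
  ultimately have "E_set \<xi> J = (\<lambda>i. vec.span {f i}) ` {..<N + 4}"
    by (simp add: E_set_def pg_pt_def f[simplified])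
  moreover have "nat (J + 4) = N + 4" by (simp add: J)
  ultimately show ?thesis
    using pg_k_arc_if_det_nonzero[OF N(3) det_nz] by simp
qed

end
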